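(* a) Let $0<p<1$ and $f\in H_p$. Then there exists an absolute constant $c_p$, depending only on $p$, such that $$|\widehat f(n)|\le c_p\, n^{1/p-1}\|f\|_{H_p}\qquad (n\in\mathbb N_+).$$ b) Let $0<p<1$ and let $\{\Phi_n:n\in\mathbb N\}$ be any non-decreasing sequence of positive numbers satisfying $$\limsup_{n\to\infty}\frac{n^{1/p-1}}{\Phi_n}=\infty .$$ Then there exists a martingale $f\in H_p$ such that $$\limsup_{n\to\infty}\frac{|\widehat f(n)|}{\Phi_n}=\infty .$$
   Context: $\mathbb N_+$ is the set of positive integers, $\mathbb N=\mathbb N_+\cup\{0\}$. Fix once and for all a bounded sequence $m=(m_0,m_1,\dots)$ of integers $m_k\ge 2$. $G_m=\prod_{k\ge0}Z_{m_k}$, where $Z_{m_k}=\{0,\dots,m_k-1\}$ is the additive group of integers modulo $m_k$, with the product of the discrete topologies, and $\mu$ is the Haar measure on $G_m$ with $\mu(G_m)=1$ (product of uniform measures). $M_0:=1$, $M_{k+1}:=m_kM_k$; every $n\in\mathbb N$ is uniquely $n=\sum_{j\ge0}n_jM_j$ with $n_j\in Z_{m_j}$. $r_k(x):=\exp(2\pi i x_k/m_k)$ and $\psi_n:=\prod_{k\ge0}r_k^{n_k}$ (Vilenkin system). $I_0(x):=G_m$, $I_n(x):=\{y\in G_m: y_0=x_0,\dots,y_{n-1}=x_{n-1}\}$; $\mathcal F_n$ is the $\sigma$-algebra generated by $\{I_n(x):x\in G_m\}$. For $g\in L_1(G_m)$: $\widehat g(k):=\int_{G_m} g\overline{\psi_k}\,d\mu$,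 $S_ng:=\sum_{k=0}^{n-1}\widehat g(k)\psi_k$. A martingale is a sequence $f=(f^{(n)}:n\in\mathbb N)$ of integrable functions such that $f^{(n)}$ is $\mathcal F_n$-measurable and $S_{M_n}f^{(k)}=f^{(n)}$ for all $n\le k$. $f^*:=\sup_n|f^{(n)}|$, $\|g\|_p:=(\int|g|^p d\mu)^{1/p}$, and $H_p$ consists of all martingales with $\|f\|_{H_p}:=\|f^*\|_p<\infty$. For a martingale, $\widehat f(i):=\lim_{k\to\infty}\int_{G_m}f^{(k)}\overline{\psi_i}\,d\mu$. The sequence $m$ is fixed, and "absolute" constants may depend on it. *)

theory Defs
  imports "HOL-Probability.Probability"
begin

text \<open>
  Points of the Vilenkin group \<open>G\<^sub>m\<close> are the functions \<open>x\<close> with \<open>x k \<in> {0,\<dots>,m k - 1}\<close> for all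
  \<open>k\<close>. The measure below is the product of the uniform probability measures. Since the product
  of countably many finite discrete spaces has the product sigma-algebra as its Borel
  sigma-algebra, this is the normalised Haar measure.
\<close>

definition vil_group :: "(nat \<Rightarrow> nat) \<Rightarrow> (nat \<Rightarrow> nat) set" where
  "vil_group m = (\<Pi>\<^sub>E k\<in>UNIV. {..<m k})"

definition vil_measure :: "(nat \<Rightarrow> nat) \<Rightarrow> (nat \<Rightarrow> nat) measure" where
  "vil_measure m = (\<Pi>\<^sub>M k\<in>UNIV. uniform_count_measure {..<m k})"

fun vil_M :: "(nat \<Rightarrow> nat) \<Rightarrow> nat \<Rightarrow> nat" where
  "vil_M m 0 = 1"
| "vil_M m (Suc k) = m k * vil_M m k"

text \<open>
  The digit \<open>n\<^sub>j\<close> in the mixed-radix expansion \<open>n = (\<Sum>j. n\<^sub>j M\<^sub>j)\<close>; the lemmas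
  \<open>vil_digit_expansion\<close> and \<open>vil_digit_unique\<close> confirm that this is the unique expansion.
\<close>

definition vil_digit :: "(nat \<Rightarrow> nat) \<Rightarrow> nat \<Rightarrow> nat \<Rightarrow> nat" where
  "vil_digit m n j = n div vil_M m j mod m j"

definition vil_r :: "(nat \<Rightarrow> nat) \<Rightarrow> nat \<Rightarrow> (nat \<Rightarrow> nat) \<Rightarrow> complex" where
  "vil_r m k x = exp (2 * of_real pi * \<i> * of_nat (x k) / of_nat (m k))"

text \<open>Only finitely many digits are nonzero (lemma \<open>finite_vil_digit\<close>); all other factors are 1.\<close>

definition vil_psi :: "(nat \<Rightarrow> nat) \<Rightarrow> nat \<Rightarrow> (nat \<Rightarrow> nat) \<Rightarrow> complex" where
  "vil_psi m n x = (\<Prod>k | vil_digit m n k \<noteq> 0. vil_r m k x ^ vil_digit m n k)"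

definition vil_I :: "(nat \<Rightarrow> nat) \<Rightarrow> nat \<Rightarrow> (nat \<Rightarrow> nat) \<Rightarrow> (nat \<Rightarrow> nat) set" where
  "vil_I m n x = {y \<in> vil_group m. \<forall>k<n. y k = x k}"

definition vil_F :: "(nat \<Rightarrow> nat) \<Rightarrow> nat \<Rightarrow> (nat \<Rightarrow> nat) measure" where
  "vil_F m n = sigma (vil_group m) (vil_I m n ` vil_group m)"

definition vil_fourier ::
  "(nat \<Rightarrow> nat) \<Rightarrow> ((nat \<Rightarrow> nat) \<Rightarrow> complex) \<Rightarrow> nat \<Rightarrow> complex" where
  "vil_fourier m g k = (\<integral>x. g x * cnj (vil_psi m k x) \<partial>vil_measure m)"

definition vil_S ::
  "(nat \<Rightarrow> nat) \<Rightarrow> nat \<Rightarrow> ((nat \<Rightarrow> nat) \<Rightarrow> complex) \<Rightarrow> (nat \<Rightarrow> nat) \<Rightarrow> complex" where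
  "vil_S m n g x = (\<Sum>k<n. vil_fourier m g k * vil_psi m k x)"

text \<open>
  The identity \<open>S\<^bsub>M\<^sub>n\<^esub> f\<^sup>(\<^sup>k\<^sup>) = f\<^sup>(\<^sup>n\<^sup>)\<close> is required pointwise on \<open>G\<^sub>m\<close>. This is no stronger than almost
  everywhere: both sides are constant on every \<open>I\<^sub>n(x)\<close>, and these sets have positive measure.
\<close>

definition vil_martingale ::
  "(nat \<Rightarrow> nat) \<Rightarrow> (nat \<Rightarrow> (nat \<Rightarrow> nat) \<Rightarrow> complex) \<Rightarrow> bool" where
  "vil_martingale m f \<longleftrightarrow>
     (\<forall>n. integrable (vil_measure m) (f n)) \<and>
     (\<forall>n. f n \<in> borel_measurable (vil_F m n)) \<and>
     (\<forall>n k. n \<le> k \<longrightarrow> (\<forall>x\<in>vil_group m. vil_S m (vil_M m n) (f k) x = f n x))"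

definition vil_maximal ::
  "(nat \<Rightarrow> (nat \<Rightarrow> nat) \<Rightarrow> complex) \<Rightarrow> (nat \<Rightarrow> nat) \<Rightarrow> ennreal" where
  "vil_maximal f x = (SUP n. ennreal (norm (f n x)))"

text \<open>The power \<open>t\<^sup>a\<close> of \<open>t \<in> [0,\<infinity>]\<close>, meant for \<open>a > 0\<close>.\<close>

definition ennreal_pow :: "ennreal \<Rightarrow> real \<Rightarrow> ennreal" where
  "ennreal_pow t a = (if t = \<infinity> then \<infinity> else ennreal (enn2real t powr a))"

definition vil_Lp_norm ::
  "(nat \<Rightarrow> nat) \<Rightarrow> real \<Rightarrow> ((nat \<Rightarrow> nat) \<Rightarrow> ennreal) \<Rightarrow> ennreal" where
  "vil_Lp_norm m p g = ennreal_pow (\<integral>\<^sup>+x. ennreal_pow (g x) p \<partial>vil_measure m) (1 / p)"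

definition vil_Hp_norm ::
  "(nat \<Rightarrow> nat) \<Rightarrow> real \<Rightarrow> (nat \<Rightarrow> (nat \<Rightarrow> nat) \<Rightarrow> complex) \<Rightarrow> ennreal" where
  "vil_Hp_norm m p f = vil_Lp_norm m p (vil_maximal f)"

definition vil_Hp ::
  "(nat \<Rightarrow> nat) \<Rightarrow> real \<Rightarrow> (nat \<Rightarrow> (nat \<Rightarrow> nat) \<Rightarrow> complex) set" where
  "vil_Hp m p = {f. vil_martingale m f \<and> vil_Hp_norm m p f < \<infinity>}"

definition vil_coeff ::
  "(nat \<Rightarrow> nat) \<Rightarrow> (nat \<Rightarrow> (nat \<Rightarrow> nat) \<Rightarrow> complex) \<Rightarrow> nat \<Rightarrow> complex" where
  "vil_coeff m f i = lim (\<lambda>k. vil_fourier m (f k) i)"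


lemma space_vil_measure: "space (vil_measure m) = vil_group m"
  by (simp add: vil_measure_def vil_group_def space_PiM space_uniform_count_measure)

lemma prob_space_vil_measure:
  assumes "\<And>k. m k \<ge> 2"
  shows "prob_space (vil_measure m)"
  unfolding vil_measure_def
proof (rule prob_space_PiM)
  fix i :: nat
  have "(0::nat) < m i" using assms[of i] by linarith
  then have "{..<m i} \<noteq> {}" by auto
  then show "prob_space (uniform_count_measure {..<m i})"
    by (intro prob_space_uniform_count_measure) auto
qed

lemma less_vil_M:
  assumes "\<And>k. m k \<ge> 2"
  shows "n < vil_M m n"
proof (induction n)
  case (Suc n)
  have "2 * vil_M m n \<le> m n * vil_M m n"
    using assms[of n] by (rule mult_le_mono1)
  with Suc have "Suc n < m n * vil_M m n" by linarith
  then show ?case by simp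
qed simp

lemma vil_digit_less:
  assumes "\<And>k. m k \<ge> 2"
  shows "vil_digit m n j < m j"
  unfolding vil_digit_def using assms[of j] by (intro mod_less_divisor) linarith

lemma vil_digit_eq_0:
  assumes "\<And>k. m k \<ge> 2" and "n \<le> j"
  shows "vil_digit m n j = 0"
proof -
  have "n < vil_M m j" using less_vil_M[of m j] assms by fastforce
  then show ?thesis by (simp add: vil_digit_def)
qed

lemma vil_digit_support:
  assumes "\<And>k. m k \<ge> 2"
  shows "{j. vil_digit m n j \<noteq> 0} \<subseteq> {..<n}"
proof
  fix j assume "j \<in> {j. vil_digit m n j \<noteq> 0}"
  then have nz: "vil_digit m n j \<noteq> 0" by simp
  have "\<not> n \<le> j"
  proof
    assume "n \<le> j"
    with assms have "vil_digit m n j = 0" by (rule vil_digit_eq_0)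
    with nz show False by contradiction
  qed
  then show "j \<in> {..<n}" by simp
qed

lemma finite_vil_digit:
  assumes "\<And>k. m k \<ge> 2"
  shows "finite {j. vil_digit m n j \<noteq> 0}"
  using vil_digit_support[of m n, OF assms] finite_lessThan by (rule finite_subset)

lemma vil_digit_expansion_mod: "(\<Sum>j<k. vil_digit m n j * vil_M m j) = n mod vil_M m k"
proof (induction k)
  case (Suc k)
  have "n mod vil_M m (Suc k) = vil_M m k * (n div vil_M m k mod m k) + n mod vil_M m k"
    using mod_mult2_eq[of n "vil_M m k" "m k"] by (simp add: mult.commute)
  with Suc show ?case by (simp add: vil_digit_def mult.commute)
qed simp

lemma vil_digit_expansion:
  assumes "\<And>k. m k \<ge> 2"
  shows "n = (\<Sum>j | vil_digit m n j \<noteq> 0. vil_digit m n j * vil_M m j)"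
proof -
  have "n = n mod vil_M m n" using less_vil_M[of m n, OF assms] by simp
  also have "\<dots> = (\<Sum>j<n. vil_digit m n j * vil_M m j)"
    by (simp add: vil_digit_expansion_mod)
  also have "\<dots> = (\<Sum>j | vil_digit m n j \<noteq> 0. vil_digit m n j * vil_M m j)"
  proof (rule sum.mono_neutral_right)
    show "{j. vil_digit m n j \<noteq> 0} \<subseteq> {..<n}"
      using assms by (rule vil_digit_support)
  qed auto
  finally show ?thesis .
qed

lemma vil_M_sum_less:
  assumes "\<And>j. d j < m j"
  shows "(\<Sum>j<k. d j * vil_M m j) < vil_M m k"
proof (induction k)
  case (Suc k)
  have "(\<Sum>j<Suc k. d j * vil_M m j) < Suc (d k) * vil_M m k" using Suc by simp
  also have "\<dots> \<le> m k * vil_M m k" using assms[of k] by (intro mult_le_mono1) simp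
  finally show ?case by simp
qed simp

lemma vil_digit_unique:
  assumes "\<And>j. d j < m j" and "n = (\<Sum>j<N. d j * vil_M m j)" and "j < N"
  shows "vil_digit m n j = d j"
proof -
  have dvd: "vil_M m i dvd vil_M m k" if "i \<le> k" for i k
    using that by (induction rule: dec_induct) auto
  have "{..<N} = {..<Suc j} \<union> {Suc j..<N}" using assms(3) by auto
  then have "n = (\<Sum>i<Suc j. d i * vil_M m i) + (\<Sum>i=Suc j..<N. d i * vil_M m i)"
    unfolding assms(2) by (simp only: sum.union_disjoint[OF finite_lessThan finite_atLeastLessThan]
        ivl_disj_int)
  moreover have "vil_M m (Suc j) dvd (\<Sum>i=Suc j..<N. d i * vil_M m i)"
    by (intro dvd_sum dvd_mult dvd) auto
  ultimately obtain q where
    n: "n = (\<Sum>i<Suc j. d i * vil_M m i) + vil_M m (Suc j) * q"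
    by (auto elim!: dvdE simp del: vil_M.simps sum.lessThan_Suc)
  have less: "(\<Sum>i<j. d i * vil_M m i) < vil_M m j" by (rule vil_M_sum_less[OF assms(1)])
  have "n = (\<Sum>i<j. d i * vil_M m i) + (d j + m j * q) * vil_M m j"
    by (simp add: n algebra_simps)
  then have "n div vil_M m j = d j + m j * q" using less by simp
  then show ?thesis using assms(1)[of j] by (simp add: vil_digit_def)
qed

end

theory Submission
  imports Defs
begin

text \<open>
  a) If \<open>n\<close> lies in \<open>[M\<^sub>N, M\<^sub>N\<^sub>+\<^sub>1)\<close>, the coefficient at \<open>n\<close> is that of \<open>f\<^sup>(\<^sup>N\<^sup>+\<^sup>1\<^sup>)\<close>, hence bounded by its
  \<open>L\<^sub>1\<close> norm. With \<open>J = \<integral> (f\<^sup>*)\<^sup>p\<close> and \<open>K = M\<^sub>N\<^sub>+\<^sub>1\<close>, constancy on cylinders of measure \<open>1/K\<close> gives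
  \<open>|f\<^sup>(\<^sup>N\<^sup>+\<^sup>1\<^sup>)|\<^sup>p \<le> K J\<close>; writing \<open>|g| = |g|\<^sup>p |g|\<^sup>1\<^sup>-\<^sup>p\<close> the \<open>L\<^sub>1\<close> norm is at most
  \<open>(K J)\<^bsup>1/p-1\<^esup> J\<close>, that is \<open>K\<^bsup>1/p-1\<^esup> \<parallel>f\<parallel>\<close>, and \<open>K = O(n)\<close>. No atomic decomposition is needed.

  b) Let the coefficients on \<open>[M\<^sub>N, M\<^sub>N\<^sub>+\<^sub>1)\<close> all be \<open>\<beta>\<^sub>N M\<^sub>N\<^bsup>1/p-1\<^esup>\<close>. The Dirichlet kernel of order \<open>M\<^sub>N\<close> is
  \<open>M\<^sub>N\<close> times the indicator of \<open>I\<^sub>N(0)\<close>, so by subadditivity of \<open>t \<mapsto> t\<^sup>p\<close> the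
  martingale lies in \<open>H\<^sub>p\<close> once \<open>\<Sum>\<^sub>N \<beta>\<^sub>N\<^sup>p\<close> converges. Since \<open>m\<close> is bounded and \<open>\<Phi>\<close> monotone,
  \<open>M\<^sub>N\<^bsup>1/p-1\<^esup> / \<Phi>(M\<^sub>N)\<close> is unbounded; take \<open>\<beta>\<close> equal to \<open>2\<^bsup>-k/p\<^esup>\<close> at the \<open>k\<close>-th term of a sequence
  along which this ratio exceeds \<open>4\<^bsup>k/p\<^esup>\<close>, and zero elsewhere.
\<close>

section \<open>Power inequalities, extended nonnegative powers and limsup\<close>

text \<open>After division by \<open>a + b\<close> the two terms lie in the unit interval and add up
  to 1, and there \<open>t \<le> t powr p\<close> because \<open>p \<le> 1\<close>.\<close>

lemma powr_add_le_add_powr: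
  fixes a b p :: real
  assumes "a \<ge> 0" "b \<ge> 0" "0 < p" "p \<le> 1"
  shows "(a + b) powr p \<le> a powr p + b powr p"
proof (cases "a + b = 0")
  case True
  then show ?thesis by simp
next
  case False
  then have pos: "a + b > 0" using assms by linarith
  have le: "t \<le> t powr p" if "0 \<le> t" "t \<le> 1" for t :: real
    using powr_mono'[of p 1 t] that assms by (cases "t = 0") simp_all
  have "1 = a / (a + b) + b / (a + b)"
    using False by (simp flip: add_divide_distrib)
  also have "\<dots> \<le> (a / (a + b)) powr p + (b / (a + b)) powr p"
  proof (rule add_mono)
    show "a / (a + b) \<le> (a / (a + b)) powr p"
      using assms pos by (intro le) (simp_all add: divide_le_eq_1)
    show "b / (a + b) \<le> (b / (a + b)) powr p"
      using assms pos by (intro le) (simp_all add: divide_le_eq_1)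
  qed
  also have "\<dots> = (a powr p + b powr p) / (a + b) powr p"
    using assms pos by (simp add: powr_divide add_divide_distrib)
  finally show ?thesis using pos by (simp add: field_simps)
qed

lemma powr_sum_le_sum_powr:
  fixes a :: "'i \<Rightarrow> real" and p :: real
  assumes "\<And>i. i \<in> A \<Longrightarrow> a i \<ge> 0" "0 < p" "p \<le> 1"
  shows "(\<Sum>i\<in>A. a i) powr p \<le> (\<Sum>i\<in>A. a i powr p)"
  using assms(1)
proof (induction A rule: infinite_finite_induct)
  case (insert i A)
  then have "(a i + (\<Sum>j\<in>A. a j)) powr p \<le> a i powr p + (\<Sum>j\<in>A. a j) powr p"
    using assms by (intro powr_add_le_add_powr) (auto intro: sum_nonneg)
  also have "\<dots> \<le> a i powr p + (\<Sum>j\<in>A. a j powr p)" using insert by simp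
  finally show ?case using insert by simp
qed simp_all

lemma ennreal_pow_ennreal: "t \<ge> 0 \<Longrightarrow> ennreal_pow (ennreal t) a = ennreal (t powr a)"
  by (simp add: ennreal_pow_def)

lemma ennreal_pow_mono:
  assumes "s \<le> t" "0 \<le> a"
  shows "ennreal_pow s a \<le> ennreal_pow t a"
proof (cases t)
  case (real r)
  with assms(1) obtain q where q: "s = ennreal q" "0 \<le> q" "q \<le> r"
    by (cases s) (auto simp: top_unique)
  with real assms(2) show ?thesis
    by (simp add: ennreal_pow_ennreal ennreal_leI powr_mono2)
qed (simp add: ennreal_pow_def)

text \<open>Bounding the bases by \<open>K powr (1 / p)\<close> before taking the supremum avoids
  commuting the power with \<open>SUP\<close>; the case of infinite \<open>K\<close> is
  trivial.\<close>

lemma ennreal_pow_SUP_le: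
  assumes "p > 0" "\<And>n. u n \<ge> 0" "\<And>n. ennreal (u n powr p) \<le> K"
  shows "ennreal_pow (SUP n. ennreal (u n)) p \<le> K"
proof (cases K)
  case (real k)
  have "u n \<le> k powr (1 / p)" for n
  proof -
    have "u n powr p \<le> k" using assms(3)[of n] real by (simp add: ennreal_le_iff)
    then have "(u n powr p) powr (1 / p) \<le> k powr (1 / p)"
      using assms(1) by (intro powr_mono2) simp_all
    then show ?thesis using assms(1) assms(2)[of n] by (simp add: powr_powr)
  qed
  then have "(SUP n. ennreal (u n)) \<le> ennreal (k powr (1 / p))"
    by (intro SUP_least ennreal_leI)
  then have "ennreal_pow (SUP n. ennreal (u n)) p \<le> ennreal_pow (ennreal (k powr (1 / p))) p"
    using assms(1) by (intro ennreal_pow_mono) simp_all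
  then show ?thesis using real assms(1) by (simp add: ennreal_pow_ennreal powr_powr)
qed simp

text \<open>Reduces both the growth hypothesis and the divergence claim of part b) to inequalities
  between real numbers.\<close>

lemma limsup_ereal_eq_PInf_iff:
  fixes u :: "nat \<Rightarrow> real"
  shows "limsup (\<lambda>n. ereal (u n)) = \<infinity> \<longleftrightarrow> (\<forall>C N. \<exists>n\<ge>N. u n > C)"
proof
  assume lim: "limsup (\<lambda>n. ereal (u n)) = \<infinity>"
  show "\<forall>C N. \<exists>n\<ge>N. u n > C"
  proof (rule ccontr)
    assume "\<not> ?thesis"
    then obtain C N where "\<And>n. n \<ge> N \<Longrightarrow> u n \<le> C" by (auto simp: not_less)
    then have "eventually (\<lambda>n. ereal (u n) \<le> ereal C) sequentially"
      by (auto simp: eventually_sequentially)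
    then have "limsup (\<lambda>n. ereal (u n)) \<le> ereal C" by (rule Limsup_bounded)
    with lim show False by simp
  qed
next
  assume *: "\<forall>C N. \<exists>n\<ge>N. u n > C"
  show "limsup (\<lambda>n. ereal (u n)) = \<infinity>"
  proof (rule ereal_top)
    fix C :: real
    show "ereal C \<le> limsup (\<lambda>n. ereal (u n))"
    proof (rule ccontr)
      assume "\<not> ?thesis"
      then have "limsup (\<lambda>n. ereal (u n)) < ereal C" by simp
      then have "eventually (\<lambda>n. ereal (u n) < ereal C) sequentially" by (rule Limsup_lessD)
      then obtain N where "\<And>n. n \<ge> N \<Longrightarrow> u n < C" by (auto simp: eventually_sequentially)
      with * show False by (meson less_asym)
    qed
  qed
qed

section \<open>The Vilenkin system\<close>

locale vilenkin =
  fixes m :: "nat \<Rightarrow> nat"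
  assumes m_ge_2: "m k \<ge> 2"
begin

lemma m_pos: "m k > 0"
  using m_ge_2[of k] by linarith

sublocale prob_space "vil_measure m"
  by (rule prob_space_vil_measure) (rule m_ge_2)

lemma M_pos: "vil_M m n > 0"
  by (induction n) (simp_all add: m_pos)

lemma M_mono: "n \<le> k \<Longrightarrow> vil_M m n \<le> vil_M m k"
proof (induction rule: dec_induct)
  case (step k)
  have "vil_M m k \<le> m k * vil_M m k"
    using m_pos[of k] by simp
  with step.IH show ?case by (simp add: order_trans)
qed simp

lemma ex_M_bracket:
  assumes "n \<ge> 1"
  obtains N where "vil_M m N \<le> n" "n < vil_M m (Suc N)"
proof -
  define K where "K = (LEAST k. n < vil_M m k)"
  have K: "n < vil_M m K"
    unfolding K_def by (rule LeastI[of _ n]) (rule less_vil_M, rule m_ge_2)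
  \<comment> \<open>The least \<open>K\<close> is not 0, since \<open>vil_M m 0 = 1\<close> and
    \<open>n \<ge> 1\<close>.\<close>
  then obtain N where N: "K = Suc N"
    using assms by (cases K) auto
  then have "\<not> n < vil_M m N"
    using not_less_Least[of N "\<lambda>k. n < vil_M m k"] unfolding K_def by simp
  with K N show ?thesis by (intro that[of N]) simp_all
qed

text \<open>Makes the definite description in \<open>block_coeff\<close> well defined; distinct
  blocks are disjoint because \<open>vil_M m\<close> is monotone.\<close>

lemma vil_M_bracket_unique:
  assumes "vil_M m N \<le> n" "n < vil_M m (Suc N)" "vil_M m K \<le> n" "n < vil_M m (Suc K)"
  shows "N = K"
  using assms M_mono[of "Suc N" K] M_mono[of "Suc K" N] by (meson leD le_trans not_less_eq_eq linorder_le_cases le_antisym)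

section \<open>Integration over coordinates and cylinders\<close>

lemma product_prob_space_uniform:
  "product_prob_space (\<lambda>k. uniform_count_measure {..<m k})"
  by (rule product_prob_spaceI, rule prob_space_uniform_count_measure) (use m_pos in auto)

lemma uniform_count_integral:
  fixes g :: "nat \<Rightarrow> complex"
  shows "integrable (uniform_count_measure {..<m k}) g"
    and "(\<integral>a. g a \<partial>uniform_count_measure {..<m k}) = (\<Sum>a<m k. g a) / of_nat (m k)"
proof -
  show "integrable (uniform_count_measure {..<m k}) g"
    by (simp add: uniform_count_measure_def integrable_point_measure_finite)
  show "(\<integral>a. g a \<partial>uniform_count_measure {..<m k}) = (\<Sum>a<m k. g a) / of_nat (m k)"
    by (simp add: uniform_count_measure_def lebesgue_integral_point_measure_finite
        sum_divide_distrib scaleR_conv_of_real)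
qed

text \<open>No regularity of \<open>g\<close> is required because each factor carries its full power
  set as sigma-algebra.\<close>

lemma measurable_coord:
  fixes g :: "nat \<Rightarrow> 'a :: topological_space"
  shows "(\<lambda>x. g (x k)) \<in> borel_measurable (vil_measure m)"
proof -
  have "(\<lambda>x. x k) \<in> measurable (vil_measure m) (uniform_count_measure {..<m k})"
    unfolding vil_measure_def by (rule measurable_component_singleton) simp
  moreover have "g \<in> borel_measurable (uniform_count_measure {..<m k})"
    by (simp add: measurable_def sets_uniform_count_measure space_uniform_count_measure)
  ultimately show ?thesis by (rule measurable_compose)
qed

text \<open>The integrand sees only the first \<open>N\<close> coordinates, so the measure can be
  pushed forward to a finite product, where the integral of a product factorises.\<close>

lemma integral_prod_coord:
  fixes g :: "nat \<Rightarrow> nat \<Rightarrow> complex"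
  shows "(\<integral>x. (\<Prod>k<N. g k (x k)) \<partial>vil_measure m) = (\<Prod>k<N. (\<Sum>a<m k. g k a) / of_nat (m k))"
proof -
  let ?U = "\<lambda>k. uniform_count_measure {..<m k}"
  interpret P: product_prob_space ?U UNIV by (rule product_prob_space_uniform)
  have g_meas: "g k \<in> borel_measurable (?U k)" for k
    by (simp add: measurable_def sets_uniform_count_measure space_uniform_count_measure)
  have meas: "(\<lambda>x. \<Prod>k<N. g k (x k)) \<in> borel_measurable (Pi\<^sub>M {..<N} ?U)"
  proof (intro borel_measurable_prod)
    fix k assume "k \<in> {..<N}"
    then show "(\<lambda>x. g k (x k)) \<in> borel_measurable (Pi\<^sub>M {..<N} ?U)"
      by (intro measurable_compose[of "\<lambda>x. x k" _ "?U k" "g k"] measurable_component_singleton g_meas)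
  qed
  have "(\<integral>x. (\<Prod>k<N. g k (x k)) \<partial>vil_measure m)
      = (\<integral>x. (\<Prod>k<N. g k (restrict x {..<N} k)) \<partial>vil_measure m)"
    by (intro Bochner_Integration.integral_cong prod.cong) auto
  also have "\<dots> = (\<integral>x. (\<Prod>k<N. g k (x k)) \<partial>distr (Pi\<^sub>M UNIV ?U) (Pi\<^sub>M {..<N} ?U) (\<lambda>x. restrict x {..<N}))"
    unfolding vil_measure_def using meas
    by (intro integral_distr[symmetric] measurable_restrict_subset) auto
  also have "\<dots> = (\<integral>x. (\<Prod>k<N. g k (x k)) \<partial>Pi\<^sub>M {..<N} ?U)"
    by (subst P.distr_PiM_restrict_finite) auto
  also have "\<dots> = (\<Prod>k<N. integral\<^sup>L (?U k) (g k))"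
    by (rule P.product_integral_prod) (auto intro: uniform_count_integral)
  finally show ?thesis by (simp add: uniform_count_integral)
qed

lemma vil_I_sets: "vil_I m N y \<in> sets (vil_measure m)"
proof -
  have "vil_I m N y = {x \<in> space (vil_measure m). \<forall>k\<in>{..<N}. x k = y k}"
    by (auto simp: vil_I_def space_vil_measure)
  also have "\<dots> \<in> sets (vil_measure m)"
  proof (intro sets.sets_Collect_finite_All)
    fix k
    have "(\<lambda>x. indicator {y k} (x k) :: real) \<in> borel_measurable (vil_measure m)"
      by (rule measurable_coord)
    then have "{x \<in> space (vil_measure m). indicator {y k} (x k) = (1::real)} \<in> sets (vil_measure m)"
      by measurable
    then show "{x \<in> space (vil_measure m). x k = y k} \<in> sets (vil_measure m)"
      by (simp add: indicator_def if_distrib cong: if_cong)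
  qed simp
  finally show ?thesis .
qed

text \<open>The indicator of a cylinder is a product of coordinate indicators, each with mean
  \<open>1 / m k\<close>. It is taken complex-valued to fit
  \<open>integral_prod_coord\<close>.\<close>

lemma prob_vil_I:
  assumes "y \<in> vil_group m"
  shows "prob (vil_I m N y) = 1 / vil_M m N"
proof -
  have ind: "indicator (vil_I m N y) x = (\<Prod>k<N. indicator {y k} (x k) :: complex)"
    if "x \<in> vil_group m" for x
    using that by (auto simp: indicator_def vil_I_def prod_zero_iff)
  have y: "y k < m k" for k
    using assms by (auto simp: vil_group_def)
  have "complex_of_real (prob (vil_I m N y))
      = (\<integral>x. complex_of_real (indicator (vil_I m N y) x) \<partial>vil_measure m)"
    using vil_I_sets by simp
  also have "\<dots> = (\<integral>x. (\<Prod>k<N. indicator {y k} (x k) :: complex) \<partial>vil_measure m)"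
    by (intro Bochner_Integration.integral_cong refl, subst ind[symmetric])
      (simp_all add: space_vil_measure indicator_def)
  also have "\<dots> = (\<Prod>k<N. 1 / of_nat (m k))"
    by (subst integral_prod_coord[of "\<lambda>k. indicator {y k}"]) (simp add: y sum.If_cases indicator_def cong: prod.cong)
  also have "\<dots> = complex_of_real (1 / vil_M m N)"
    by (induction N) simp_all
  finally show ?thesis by (simp only: of_real_eq_iff)
qed

lemma emeasure_vil_I:
  "y \<in> vil_group m \<Longrightarrow> emeasure (vil_measure m) (vil_I m N y) = ennreal (1 / vil_M m N)"
  by (simp add: emeasure_eq_measure prob_vil_I)

section \<open>Characters and their orthonormality\<close>

lemma vil_r_cis: "vil_r m k x = cis (2 * pi * real (x k) / real (m k))"
  by (simp add: vil_r_def cis_conv_exp mult_ac)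

lemma digit_eq_0: "n < vil_M m k \<Longrightarrow> vil_digit m n k = 0"
  by (simp add: vil_digit_def)

lemma psi_eq_prod:
  assumes "n < vil_M m N"
  shows "vil_psi m n x = (\<Prod>k<N. vil_r m k x ^ vil_digit m n k)"
proof -
  have "{k. vil_digit m n k \<noteq> 0} \<subseteq> {..<N}"
    using digit_eq_0 less_le_trans[OF assms M_mono] by (force simp: not_less[symmetric])
  then show ?thesis
    unfolding vil_psi_def by (intro prod.mono_neutral_left) auto
qed

lemma norm_psi: "norm (vil_psi m n x) = 1"
  by (simp add: vil_psi_def vil_r_cis prod_norm[symmetric] norm_power)

lemma psi_measurable: "vil_psi m n \<in> borel_measurable (vil_measure m)"
  unfolding vil_psi_def vil_r_def
  by (intro borel_measurable_prod borel_measurable_power measurable_coord)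

lemma psi_cong:
  assumes "n < vil_M m N" "\<And>k. k < N \<Longrightarrow> x k = y k"
  shows "vil_psi m n x = vil_psi m n y"
  unfolding psi_eq_prod[OF assms(1)] using assms(2) by (intro prod.cong) (simp_all add: vil_r_def)

text \<open>A geometric sum whose ratio is an \<open>n\<close>-th root of unity; as
  \<open>cnj v\<close> is the inverse of \<open>v\<close>, the ratio is 1 exactly when
  \<open>u = v\<close>.\<close>

lemma sum_roots_unity:
  fixes u v :: complex
  assumes "norm v = 1" "u ^ n = 1" "v ^ n = 1"
  shows "(\<Sum>a<n. (u * cnj v) ^ a) = (if u = v then of_nat n else 0)"
proof (cases "u = v")
  case True
  then show ?thesis using assms(1) by (simp add: complex_norm_square[symmetric])
next
  case False
  have v: "v * cnj v = 1" using assms(1) by (simp add: complex_norm_square[symmetric])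
  have "u * cnj v \<noteq> 1"
  proof
    assume "u * cnj v = 1"
    then have "u * (v * cnj v) = v" by (simp add: mult_ac)
    with v False show False by simp
  qed
  moreover have "(u * cnj v) ^ n = 1"
    using assms by (simp add: power_mult_distrib flip: complex_cnj_power)
  ultimately show ?thesis using False by (simp add: sum_gp_strict)
qed

lemma cis_root:
  assumes "n > 0"
  shows "cis (2 * pi * real a / real n) ^ n = 1"
proof -
  have "real n * (2 * pi * real a / real n) = 2 * pi * real a" using assms by simp
  then show ?thesis by (simp only: Complex.DeMoivre cis_multiple_2pi Ints_of_nat)
qed

lemma cis_root_eq_iff:
  assumes "a < n" "b < n"
  shows "cis (2 * pi * real a / real n) = cis (2 * pi * real b / real n) \<longleftrightarrow> a = b"
  using inj_on_eq_iff[OF bij_betw_imp_inj_on[OF Complex.bij_betw_roots_unity[of n]], of a b] assms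
  by simp

text \<open>The integral factorises into the orthogonality relations of the cyclic groups of order
  \<open>m k\<close>, so it vanishes as soon as one digit differs.\<close>

lemma psi_orthonormal:
  "(\<integral>x. vil_psi m i x * cnj (vil_psi m j x) \<partial>vil_measure m) = (if i = j then 1 else 0)"
proof -
  \<comment> \<open>Any \<open>N\<close> with both indices below \<open>vil_M m N\<close> would do;
    the sum works since \<open>n < vil_M m n\<close>.\<close>
  define N where "N = i + j"
  have i: "i < vil_M m N"
    using less_vil_M[of m i, OF m_ge_2] M_mono[of i N] by (simp add: N_def)
  have j: "j < vil_M m N"
    using less_vil_M[of m j, OF m_ge_2] M_mono[of j N] by (simp add: N_def)
  define g where "g k a = vil_r m k (\<lambda>_. a) ^ vil_digit m i k * cnj (vil_r m k (\<lambda>_. a) ^ vil_digit m j k)" for k a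
  define e where "e d k = cis (2 * pi * real d / real (m k))" for d k
  \<comment> \<open>The roles of point and digit are symmetric. Moving \<open>a\<close> into the
    exponent turns the sum over \<open>a\<close> into a geometric one.\<close>
  have pow: "vil_r m k (\<lambda>_. a) ^ d = e d k ^ a" for k a d
    by (simp only: e_def vil_r_cis Complex.DeMoivre) (simp add: mult_ac)
  have dig: "vil_digit m n k < m k" for n k
    by (rule vil_digit_less) (rule m_ge_2)
  have "(\<Sum>a<m k. g k a) = (if vil_digit m i k = vil_digit m j k then of_nat (m k) else 0)" for k
  proof -
    have "(\<Sum>a<m k. g k a) = (\<Sum>a<m k. (e (vil_digit m i k) k * cnj (e (vil_digit m j k) k)) ^ a)"
      by (simp add: g_def pow power_mult_distrib)
    also have "\<dots> = (if e (vil_digit m i k) k = e (vil_digit m j k) k then of_nat (m k) else 0)"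
      by (rule sum_roots_unity) (simp_all add: e_def cis_root m_pos)
    finally show ?thesis by (simp only: e_def cis_root_eq_iff dig)
  qed
  moreover have "(\<integral>x. vil_psi m i x * cnj (vil_psi m j x) \<partial>vil_measure m)
      = (\<integral>x. (\<Prod>k<N. g k (x k)) \<partial>vil_measure m)"
    by (simp add: psi_eq_prod[OF i] psi_eq_prod[OF j] g_def prod.distrib vil_r_def)
  ultimately have eq: "(\<integral>x. vil_psi m i x * cnj (vil_psi m j x) \<partial>vil_measure m)
      = (\<Prod>k<N. if vil_digit m i k = vil_digit m j k then 1 else 0)"
    using m_pos by (simp add: integral_prod_coord if_distrib[of "\<lambda>z. z / _"] less_imp_neq[symmetric] cong: if_cong)
  show ?thesis
  proof (cases "\<forall>k<N. vil_digit m i k = vil_digit m j k")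
    case True
    \<comment> \<open>The first \<open>N\<close> digits determine an index modulo
      \<open>vil_M m N\<close>, and both indices are below that modulus.\<close>
    then have "(\<Sum>k<N. vil_digit m i k * vil_M m k) = (\<Sum>k<N. vil_digit m j k * vil_M m k)"
      by simp
    then have "i = j" using i j by (simp add: vil_digit_expansion_mod)
    with eq show ?thesis by simp
  next
    case False
    with eq show ?thesis by (auto simp: prod_zero_iff)
  qed
qed

text \<open>Adding \<open>d * vil_M m N\<close> to \<open>l\<close> makes digit \<open>N\<close>
  equal to \<open>d\<close> and leaves the lower digits alone.\<close>

lemma psi_digit_shift:
  assumes "l < vil_M m N" "d < m N"
  shows "vil_psi m (l + d * vil_M m N) x = vil_psi m l x * vil_r m N x ^ d"
proof -
  let ?n = "l + d * vil_M m N"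
  have "?n < Suc d * vil_M m N" using assms by simp
  also have "\<dots> \<le> vil_M m (Suc N)"
    unfolding vil_M.simps using assms by (intro mult_le_mono1) simp
  finally have n: "?n < vil_M m (Suc N)" .
  have top: "vil_digit m ?n N = d" using assms M_pos[of N] by (simp add: vil_digit_def)
  \<comment> \<open>Since \<open>vil_M m (Suc k)\<close> divides \<open>vil_M m N\<close>, the
    quotient by \<open>vil_M m k\<close> changes by a multiple of \<open>m k\<close>.\<close>
  have low: "vil_digit m ?n k = vil_digit m l k" if "k < N" for k
  proof -
    have "vil_M m (Suc k) dvd vil_M m N" using Suc_leI[OF that] by (induction rule: dec_induct) auto
    then obtain q where q: "vil_M m N = m k * vil_M m k * q" by (auto elim: dvdE)
    have "?n = l + (d * q * m k) * vil_M m k" by (simp add: q mult_ac)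
    then have "?n div vil_M m k = d * q * m k + l div vil_M m k"
      using M_pos[of k] by (simp only: div_mult_self1)
    then show ?thesis by (simp add: vil_digit_def)
  qed
  show ?thesis
    unfolding psi_eq_prod[OF n] psi_eq_prod[OF assms(1)] by (simp add: top low)
qed

section \<open>The Dirichlet kernel of order \<open>vil_M m N\<close>\<close>

definition dirichlet :: "nat \<Rightarrow> (nat \<Rightarrow> nat) \<Rightarrow> complex" where
  "dirichlet n x = (\<Sum>j<n. vil_psi m j x)"

text \<open>Cutting the index range into \<open>m N\<close> blocks of length
  \<open>vil_M m N\<close> splits off the factor \<open>\<Sum>d<m N. vil_r m N x ^ d\<close>, a sum
  over roots of unity that vanishes unless \<open>x N = 0\<close>.\<close>

lemma dirichlet_M:
  assumes "x \<in> vil_group m"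
  shows "dirichlet (vil_M m N) x = (if \<forall>k<N. x k = 0 then of_nat (vil_M m N) else 0)"
proof (induction N)
  case 0
  show ?case by (simp add: dirichlet_def psi_eq_prod[of 0 0])
next
  case (Suc N)
  have xN: "x N < m N" using assms by (auto simp: vil_group_def)
  have "dirichlet (vil_M m (Suc N)) x
      = (\<Sum>d<m N. \<Sum>l<vil_M m N. vil_psi m (l + d * vil_M m N) x)"
    unfolding dirichlet_def using sum.nat_group[of "\<lambda>j. vil_psi m j x" "vil_M m N" "m N"]
    by (simp add: sum.atLeastLessThan_shift_0 atLeast0LessThan add.commute mult.commute)
  also have "\<dots> = (\<Sum>d<m N. \<Sum>l<vil_M m N. vil_psi m l x * vil_r m N x ^ d)"
    by (intro sum.cong refl psi_digit_shift) auto
  also have "\<dots> = dirichlet (vil_M m N) x * (\<Sum>d<m N. vil_r m N x ^ d)"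
    by (simp add: dirichlet_def sum_distrib_left sum_distrib_right)
  also have "(\<Sum>d<m N. vil_r m N x ^ d) = (if x N = 0 then of_nat (m N) else 0)"
    using sum_roots_unity[of 1 "vil_r m N x" "m N"] cis_root_eq_iff[OF xN m_pos]
    by (simp add: vil_r_cis cis_root m_pos)
  finally show ?case unfolding Suc.IH by (auto simp: less_Suc_eq)
qed

lemma zero_in_group: "(\<lambda>_. 0) \<in> vil_group m"
  by (simp add: vil_group_def PiE_iff m_pos)

section \<open>Martingales and their coefficients\<close>

text \<open>There are only finitely many cylinders of depth \<open>n\<close>, and every preimage
  under \<open>g\<close> is a union of some of them.\<close>

lemma cylinder_measurable:
  fixes g :: "(nat \<Rightarrow> nat) \<Rightarrow> 'a :: topological_space"
  assumes "\<And>x y. \<lbrakk>x \<in> vil_group m; y \<in> vil_group m; \<And>k. k < n \<Longrightarrow> x k = y k\<rbrakk> \<Longrightarrow> g x = g y"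
  shows "g \<in> borel_measurable (vil_F m n)"
proof (rule measurableI)
  have sub: "vil_I m n ` vil_group m \<subseteq> Pow (vil_group m)" by (auto simp: vil_I_def)
  have sp: "space (vil_F m n) = vil_group m"
    by (simp add: vil_F_def space_measure_of[OF sub])
  have fin: "finite (vil_I m n ` vil_group m)"
  proof -
    \<comment> \<open>A cylinder is determined by the first \<open>n\<close> coordinates of its
      centre, which range over a finite product.\<close>
    have "vil_I m n ` vil_group m = vil_I m n ` (\<lambda>x. restrict x {..<n}) ` vil_group m"
      by (simp add: image_image vil_I_def)
    moreover have "(\<lambda>x. restrict x {..<n}) ` vil_group m \<subseteq> (\<Pi>\<^sub>E k\<in>{..<n}. {..<m k})"
      by (auto simp: vil_group_def PiE_iff split: if_splits)
    ultimately show ?thesis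
      by (metis finite_PiE finite_imageI finite_lessThan finite_subset)
  qed
  fix A :: "'a set"
  have "g -` A \<inter> space (vil_F m n) = \<Union> (vil_I m n ` {x \<in> vil_group m. g x \<in> A})"
  proof -
    have "g y = g x" if "x \<in> vil_group m" "y \<in> vil_I m n x" for x y
      by (rule assms) (use that in \<open>auto simp: vil_I_def\<close>)
    moreover have "x \<in> vil_I m n x" if "x \<in> vil_group m" for x
      using that by (simp add: vil_I_def)
    ultimately show ?thesis unfolding sp using sub by fast
  qed
  also have "\<dots> \<in> sets (vil_F m n)"
  proof (rule sets.finite_Union)
    show "finite (vil_I m n ` {x \<in> vil_group m. g x \<in> A})"
      by (rule finite_subset[OF _ fin]) auto
    show "vil_I m n ` {x \<in> vil_group m. g x \<in> A} \<subseteq> sets (vil_F m n)"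
      using sub by (auto simp: vil_F_def intro: in_measure_of)
  qed
  finally show "g -` A \<inter> space (vil_F m n) \<in> sets (vil_F m n)" .
qed simp

lemma integrable_psi_mult:
  "integrable (vil_measure m) (\<lambda>x. vil_psi m i x * cnj (vil_psi m j x))"
  by (rule integrable_const_bound[of _ 1])
    (auto simp: norm_mult norm_psi intro!: borel_measurable_times psi_measurable
      measurable_compose[OF psi_measurable borel_measurable_continuous_onI] continuous_intros)

lemma fourier_polynomial:
  "vil_fourier m (\<lambda>x. \<Sum>j<n. c j * vil_psi m j x) i = (if i < n then c i else 0)"
proof -
  have "vil_fourier m (\<lambda>x. \<Sum>j<n. c j * vil_psi m j x) i
      = (\<integral>x. (\<Sum>j<n. c j * (vil_psi m j x * cnj (vil_psi m i x))) \<partial>vil_measure m)"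
    by (simp add: vil_fourier_def sum_distrib_right mult.assoc)
  also have "\<dots> = (\<Sum>j<n. c j * (if j = i then 1 else 0))"
    by (subst Bochner_Integration.integral_sum)
      (simp_all add: integrable_psi_mult psi_orthonormal)
  finally show ?thesis by (simp add: if_distrib cong: if_cong)
qed

text \<open>Partial sums truncate a polynomial, so an arbitrary coefficient sequence yields a
  martingale; the example for b) arises this way.\<close>

lemma martingale_polynomial:
  "vil_martingale m (\<lambda>n x. \<Sum>j<vil_M m n. c j * vil_psi m j x)"
  unfolding vil_martingale_def
proof (intro conjI allI impI ballI)
  fix n
  have "integrable (vil_measure m) (vil_psi m j)" for j
    by (rule integrable_const_bound[of _ 1]) (auto simp: norm_psi psi_measurable)
  then show "integrable (vil_measure m) (\<lambda>x. \<Sum>j<vil_M m n. c j * vil_psi m j x)"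
    by simp
  show "(\<lambda>x. \<Sum>j<vil_M m n. c j * vil_psi m j x) \<in> borel_measurable (vil_F m n)"
    by (rule cylinder_measurable) (auto intro!: sum.cong psi_cong)
next
  fix n k :: nat and x assume "n \<le> k"
  then show "vil_S m (vil_M m n) (\<lambda>x. \<Sum>j<vil_M m k. c j * vil_psi m j x) x
      = (\<Sum>j<vil_M m n. c j * vil_psi m j x)"
    using M_mono[of n k] unfolding vil_S_def fourier_polynomial by (intro sum.cong) auto
qed

lemma martingale_fourier:
  assumes f: "vil_martingale m f" and "i < vil_M m n" "n \<le> k"
  shows "vil_fourier m (f k) i = vil_fourier m (f n) i"
proof -
  have "vil_fourier m (f n) i = vil_fourier m (vil_S m (vil_M m n) (f k)) i"
    unfolding vil_fourier_def using assms
    by (intro Bochner_Integration.integral_cong refl)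
      (simp add: vil_martingale_def space_vil_measure)
  also have "\<dots> = vil_fourier m (f k) i"
    unfolding vil_S_def fourier_polynomial using assms(2) by simp
  finally show ?thesis ..
qed

text \<open>The sequence defining the coefficient is constant from stage \<open>n\<close>
  on.\<close>

lemma martingale_coeff:
  assumes "vil_martingale m f" and "i < vil_M m n"
  shows "vil_coeff m f i = vil_fourier m (f n) i"
  unfolding vil_coeff_def
  by (intro limI tendsto_eventually eventually_mono[OF eventually_ge_at_top[of n]])
    (rule martingale_fourier[OF assms])

text \<open>Obtained from the partial sum identity with \<open>k = n\<close>: the characters of
  index below \<open>vil_M m n\<close> depend on the first \<open>n\<close> coordinates
  only.\<close>

lemma martingale_cylinder:
  assumes f: "vil_martingale m f" and "x \<in> vil_group m" "y \<in> vil_I m n x"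
  shows "f n y = f n x"
proof -
  have S: "f n z = vil_S m (vil_M m n) (f n) z" if "z \<in> vil_group m" for z
    using f that by (simp add: vil_martingale_def)
  have "vil_S m (vil_M m n) (f n) y = vil_S m (vil_M m n) (f n) x"
    using assms(3) unfolding vil_S_def
    by (intro sum.cong refl arg_cong2[of _ _ _ _ "(*)"] psi_cong[of _ n]) (auto simp: vil_I_def)
  with S assms show ?thesis by (simp add: vil_I_def)
qed

section \<open>Bounds for the coefficients\<close>

text \<open>A Chebyshev argument: the maximal function is at least \<open>norm (f n x)\<close> on
  the whole cylinder around \<open>x\<close>, whose measure is \<open>1 / vil_M m n\<close>.\<close>

lemma martingale_pointwise_bound:
  fixes J p :: real
  assumes f: "vil_martingale m f" and "p > 0" "J \<ge> 0"
    and J: "(\<integral>\<^sup>+x. ennreal_pow (vil_maximal f x) p \<partial>vil_measure m) = ennreal J"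
    and x: "x \<in> vil_group m"
  shows "norm (f n x) powr p \<le> vil_M m n * J"
proof -
  let ?c = "norm (f n x) powr p"
  have "ennreal (?c * (1 / vil_M m n)) = ennreal ?c * emeasure (vil_measure m) (vil_I m n x)"
    by (subst ennreal_mult) (simp_all add: x emeasure_vil_I)
  also have "\<dots> = (\<integral>\<^sup>+y. ennreal ?c * indicator (vil_I m n x) y \<partial>vil_measure m)"
    by (simp add: nn_integral_cmult_indicator vil_I_sets)
  also have "\<dots> \<le> (\<integral>\<^sup>+y. ennreal_pow (vil_maximal f y) p \<partial>vil_measure m)"
  proof (rule nn_integral_mono)
    fix y
    show "ennreal ?c * indicator (vil_I m n x) y \<le> ennreal_pow (vil_maximal f y) p"
    proof (cases "y \<in> vil_I m n x")
      case True
      then have "ennreal (norm (f n x)) \<le> vil_maximal f y"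
        unfolding vil_maximal_def martingale_cylinder[OF f x True, symmetric] by (intro SUP_upper) simp
      then have "ennreal_pow (ennreal (norm (f n x))) p \<le> ennreal_pow (vil_maximal f y) p"
        using \<open>p > 0\<close> by (intro ennreal_pow_mono) simp_all
      then show ?thesis using True by (simp add: ennreal_pow_ennreal)
    qed simp
  qed
  finally have "?c * (1 / vil_M m n) \<le> J"
    using \<open>J \<ge> 0\<close> by (simp add: J ennreal_le_iff)
  then show ?thesis using M_pos[of n] by (simp add: field_simps)
qed

lemma martingale_integral_bound:
  fixes J p :: real
  assumes f: "vil_martingale m f" and p: "0 < p" "p < 1" and "J \<ge> 0"
    and J: "(\<integral>\<^sup>+x. ennreal_pow (vil_maximal f x) p \<partial>vil_measure m) = ennreal J"
  shows "(\<integral>x. norm (f n x) \<partial>vil_measure m) \<le> (vil_M m n * J) powr (1 / p - 1) * J"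
proof -
  let ?\<mu> = "vil_measure m"
  have int_f: "integrable ?\<mu> (\<lambda>x. norm (f n x))"
    using f by (simp add: vil_martingale_def)
  have meas: "f n \<in> borel_measurable ?\<mu>"
    using f unfolding vil_martingale_def by (blast intro: borel_measurable_integrable)
  have pt: "norm (f n x) powr p \<le> vil_M m n * J" if "x \<in> vil_group m" for x
    using martingale_pointwise_bound[OF f p(1) \<open>J \<ge> 0\<close> J that] .
  have int_p: "integrable ?\<mu> (\<lambda>x. norm (f n x) powr p)"
    by (rule integrable_const_bound[of _ "vil_M m n * J"])
      (use meas pt in \<open>auto simp: space_vil_measure intro!: AE_I2\<close>)
  have "ennreal (\<integral>x. norm (f n x) powr p \<partial>?\<mu>) = (\<integral>\<^sup>+x. ennreal (norm (f n x) powr p) \<partial>?\<mu>)"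
    by (rule nn_integral_eq_integral[OF int_p, symmetric]) simp
  also have "\<dots> \<le> ennreal J"
    unfolding J[symmetric]
  proof (rule nn_integral_mono)
    fix x
    have "ennreal_pow (ennreal (norm (f n x))) p \<le> ennreal_pow (vil_maximal f x) p"
      unfolding vil_maximal_def using p by (intro ennreal_pow_mono SUP_upper) simp_all
    then show "ennreal (norm (f n x) powr p) \<le> ennreal_pow (vil_maximal f x) p"
      by (simp add: ennreal_pow_ennreal)
  qed
  finally have int_le: "(\<integral>x. norm (f n x) powr p \<partial>?\<mu>) \<le> J"
    using \<open>J \<ge> 0\<close> by (simp add: ennreal_le_iff)
  let ?K = "(vil_M m n * J) powr (1 / p - 1)"
  have "norm (f n x) \<le> ?K * norm (f n x) powr p" if "x \<in> space ?\<mu>" for x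
  proof -
    have "norm (f n x) = norm (f n x) powr ((1 - p) + p)" by simp
    also have "\<dots> = norm (f n x) powr (1 - p) * norm (f n x) powr p"
      by (rule powr_add)
    \<comment> \<open>Rewritten so that the pointwise bound on the \<open>p\<close>-th power
      applies.\<close>
    also have "norm (f n x) powr (1 - p) = (norm (f n x) powr p) powr (1 / p - 1)"
      using p by (simp add: powr_powr algebra_simps)
    also have "\<dots> \<le> ?K"
      using p pt[of x] that by (intro powr_mono2) (simp_all add: space_vil_measure)
    finally show ?thesis by (simp add: mult_right_mono)
  qed
  then have "(\<integral>x. norm (f n x) \<partial>?\<mu>) \<le> (\<integral>x. ?K * norm (f n x) powr p \<partial>?\<mu>)"
    using int_f int_p by (intro integral_mono) auto
  also have "\<dots> \<le> ?K * J"
    using int_le by (simp add: mult_left_mono)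
  finally show ?thesis .
qed

lemma norm_fourier_le: "norm (vil_fourier m g i) \<le> (\<integral>x. norm (g x) \<partial>vil_measure m)"
  unfolding vil_fourier_def
  using integral_norm_bound[of "vil_measure m" "\<lambda>x. g x * cnj (vil_psi m i x)"]
  by (simp add: norm_mult norm_psi)

lemma Hp_coeff_bound:
  assumes f: "f \<in> vil_Hp m p" and p: "0 < p" "p < 1" and B: "\<And>k. m k \<le> B" and "n \<ge> 1"
  shows "norm (vil_coeff m f n)
    \<le> real B powr (1 / p - 1) * real n powr (1 / p - 1) * enn2real (vil_Hp_norm m p f)"
proof -
  let ?q = "1 / p - 1"
  have q: "?q > 0" using p by simp
  have mart: "vil_martingale m f" and fin: "vil_Hp_norm m p f < \<infinity>"
    using f by (auto simp: vil_Hp_def)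
  let ?I = "\<integral>\<^sup>+x. ennreal_pow (vil_maximal f x) p \<partial>vil_measure m"
  \<comment> \<open>\<open>ennreal_pow\<close> sends infinity to infinity, so a finite norm forces a
    finite integral.\<close>
  have "?I \<noteq> \<infinity>"
    using fin by (auto simp: vil_Hp_norm_def vil_Lp_norm_def ennreal_pow_def)
  then obtain J where J: "?I = ennreal J" "J \<ge> 0"
    by (cases ?I) auto
  then have norm_eq: "enn2real (vil_Hp_norm m p f) = J powr (1 / p)"
    by (simp add: vil_Hp_norm_def vil_Lp_norm_def ennreal_pow_ennreal)
  obtain N where N: "vil_M m N \<le> n" "n < vil_M m (Suc N)"
    using ex_M_bracket[OF \<open>n \<ge> 1\<close>] .
  \<comment> \<open>Boundedness of \<open>m\<close> enters here: passing from \<open>n\<close> to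
    the end of its block costs a factor of at most \<open>B\<close>, the source of the
    constant.\<close>
  have "vil_M m (Suc N) \<le> B * n"
    using N(1) B[of N] by (simp add: mult_le_mono)
  then have M_le: "real (vil_M m (Suc N)) \<le> real B * real n"
    by (simp flip: of_nat_mult del: vil_M.simps)
  have "norm (vil_coeff m f n) \<le> (\<integral>x. norm (f (Suc N) x) \<partial>vil_measure m)"
    unfolding martingale_coeff[OF mart N(2)] by (rule norm_fourier_le)
  also have "\<dots> \<le> (vil_M m (Suc N) * J) powr ?q * J"
    by (rule martingale_integral_bound[OF mart p J(2,1)])
  also have "\<dots> \<le> (real B * real n * J) powr ?q * J"
    using M_le q J(2) by (intro mult_right_mono powr_mono2) (simp_all del: vil_M.simps)
  also have "\<dots> = real B powr ?q * real n powr ?q * (J powr ?q * J)"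
    using J(2) by (simp add: powr_mult)
  also have "J powr ?q * J = J powr (1 / p)"
    using J(2) powr_add[of J ?q 1] by simp
  finally show ?thesis by (simp add: norm_eq)
qed

section \<open>Martingales with constant Fourier blocks\<close>

text \<open>The index 0 lies in no block \<open>{vil_M m N..<vil_M m (Suc N)}\<close>.\<close>

definition block_coeff :: "(nat \<Rightarrow> complex) \<Rightarrow> nat \<Rightarrow> complex" where
  "block_coeff w j = (if j = 0 then 0 else w (THE N. vil_M m N \<le> j \<and> j < vil_M m (Suc N)))"

definition block_martingale :: "(nat \<Rightarrow> complex) \<Rightarrow> nat \<Rightarrow> (nat \<Rightarrow> nat) \<Rightarrow> complex" where
  "block_martingale w n x = (\<Sum>j<vil_M m n. block_coeff w j * vil_psi m j x)"

lemma block_coeff_eq: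
  assumes "vil_M m N \<le> j" "j < vil_M m (Suc N)"
  shows "block_coeff w j = w N"
proof -
  have "(THE N. vil_M m N \<le> j \<and> j < vil_M m (Suc N)) = N"
    using assms vil_M_bracket_unique by (intro the_equality) blast+
  then show ?thesis
    using assms(1) M_pos[of N] by (simp add: block_coeff_def)
qed

lemma martingale_block_martingale: "vil_martingale m (block_martingale w)"
  using martingale_polynomial[of "block_coeff w"]
  by (simp add: block_martingale_def[abs_def])

lemma coeff_block_martingale: "vil_coeff m (block_martingale w) (vil_M m N) = w N"
proof -
  \<comment> \<open>Block \<open>N\<close> is nonempty because \<open>m N \<ge> 2\<close>, and its
    first index is \<open>vil_M m N\<close>.\<close>
  have "1 * vil_M m N < m N * vil_M m N"
    using M_pos[of N] m_ge_2[of N] by (intro mult_strict_right_mono) simp_all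
  then have less: "vil_M m N < vil_M m (Suc N)" by simp
  have "vil_coeff m (block_martingale w) (vil_M m N)
      = vil_fourier m (block_martingale w (Suc N)) (vil_M m N)"
    by (rule martingale_coeff[OF martingale_block_martingale less])
  also have "\<dots> = block_coeff w (vil_M m N)"
    unfolding block_martingale_def[abs_def] fourier_polynomial using less by simp
  finally show ?thesis using less by (simp add: block_coeff_eq)
qed

text \<open>With constant coefficients on a block, the block sum is a multiple of a difference of
  two kernels known from \<open>dirichlet_M\<close>.\<close>

lemma block_martingale_eq:
  "block_martingale w n x
    = (\<Sum>N<n. w N * (dirichlet (vil_M m (Suc N)) x - dirichlet (vil_M m N) x))"
proof (induction n)
  case 0
  \<comment> \<open>At stage 0 only index 0 occurs; its coefficient is 0, matching the empty
    sum.\<close>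
  show ?case by (simp add: block_martingale_def block_coeff_def)
next
  case (Suc n)
  have split: "(\<Sum>j<vil_M m (Suc n). g j) = (\<Sum>j<vil_M m n. g j) + (\<Sum>j=vil_M m n..<vil_M m (Suc n). g j)"
    for g :: "nat \<Rightarrow> complex"
    using sum.atLeastLessThan_concat[of 0 "vil_M m n" "vil_M m (Suc n)" g] M_mono[of n "Suc n"]
    by (simp add: atLeast0LessThan del: vil_M.simps)
  have "block_martingale w (Suc n) x
      = block_martingale w n x + (\<Sum>j=vil_M m n..<vil_M m (Suc n). block_coeff w j * vil_psi m j x)"
    unfolding block_martingale_def by (rule split)
  also have "(\<Sum>j=vil_M m n..<vil_M m (Suc n). block_coeff w j * vil_psi m j x)
      = (\<Sum>j=vil_M m n..<vil_M m (Suc n). w n * vil_psi m j x)"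
    by (intro sum.cong) (simp_all add: block_coeff_eq del: vil_M.simps)
  also have "\<dots> = w n * (dirichlet (vil_M m (Suc n)) x - dirichlet (vil_M m n) x)"
    unfolding dirichlet_def split by (simp add: sum_distrib_left)
  finally show ?case by (simp add: Suc.IH)
qed

text \<open>The difference is \<open>vil_M m (Suc N) - vil_M m N\<close> on the cylinder of depth
  \<open>Suc N\<close> at 0, \<open>- vil_M m N\<close> on the rest of the one of depth
  \<open>N\<close>, and 0 elsewhere.\<close>

lemma norm_dirichlet_diff_le:
  assumes "x \<in> vil_group m" and B: "\<And>k. m k \<le> B"
  shows "norm (dirichlet (vil_M m (Suc N)) x - dirichlet (vil_M m N) x)
    \<le> real B * real (vil_M m N) * indicator (vil_I m N (\<lambda>_. 0)) x"
proof -
  have le: "vil_M m N \<le> vil_M m (Suc N)" by (rule M_mono) simp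
  have "vil_M m (Suc N) \<le> B * vil_M m N" using B[of N] by simp
  then have le': "real (vil_M m (Suc N)) \<le> real B * real (vil_M m N)"
    by (simp flip: of_nat_mult del: vil_M.simps)
  consider "\<forall>k<Suc N. x k = 0" | "\<forall>k<N. x k = 0" "x N \<noteq> 0" | "\<not> (\<forall>k<N. x k = 0)"
    by (metis less_Suc_eq)
  then show ?thesis
  proof cases
    case 1
    then have "norm (dirichlet (vil_M m (Suc N)) x - dirichlet (vil_M m N) x)
        = real (vil_M m (Suc N)) - real (vil_M m N)"
      using le norm_of_nat[of "vil_M m (Suc N) - vil_M m N", where 'a = complex]
      by (simp add: dirichlet_M[OF assms(1)] of_nat_diff del: vil_M.simps)
    with 1 le' assms(1) show ?thesis by (simp add: vil_I_def del: vil_M.simps)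
  next
    case 2
    then have "norm (dirichlet (vil_M m (Suc N)) x - dirichlet (vil_M m N) x) = real (vil_M m N)"
      by (auto simp: dirichlet_M[OF assms(1)] simp del: vil_M.simps)
    moreover have "real (vil_M m N) \<le> real B * real (vil_M m N)"
      using le le' by linarith
    ultimately show ?thesis using 2 assms(1) by (simp add: vil_I_def del: vil_M.simps)
  next
    case 3
    then have "\<not> (\<forall>k<Suc N. x k = 0)" by (meson less_SucI)
    with 3 show ?thesis by (auto simp: dirichlet_M[OF assms(1)] simp del: vil_M.simps)
  qed
qed

text \<open>The exponent \<open>1 / p - 1\<close> is chosen so that weight times kernel has size
  \<open>vil_M m N powr (1 / p)\<close>. Its \<open>p\<close>-th power cancels the measure of the
  supporting cylinder, leaving a multiple of \<open>\<beta> N powr p\<close>.\<close>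

lemma block_martingale_in_Hp:
  fixes \<beta> :: "nat \<Rightarrow> real"
  assumes p: "0 < p" "p < 1" and B: "\<And>k. m k \<le> B"
    and nonneg: "\<And>N. \<beta> N \<ge> 0" and summable: "summable (\<lambda>N. \<beta> N powr p)"
  shows "block_martingale (\<lambda>N. of_real (\<beta> N * vil_M m N powr (1 / p - 1))) \<in> vil_Hp m p"
proof -
  let ?w = "\<lambda>N. complex_of_real (\<beta> N * vil_M m N powr (1 / p - 1))"
  let ?f = "block_martingale ?w"
  let ?E = "\<lambda>N. vil_I m N (\<lambda>_. 0)"
  define c where "c N = real B powr p * \<beta> N powr p" for N
  \<comment> \<open>A majorant for the \<open>p\<close>-th power of every stage, independent of the
    stage and hence valid for the maximal function.\<close>
  define K where "K x = (\<Sum>N. ennreal (c N * vil_M m N) * indicator (?E N) x)" for x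
  have c_nonneg: "c N \<ge> 0" for N by (simp add: c_def)
  have bound: "ennreal_pow (vil_maximal ?f x) p \<le> K x" if x: "x \<in> vil_group m" for x
    unfolding vil_maximal_def
  proof (rule ennreal_pow_SUP_le)
    fix n
    \<comment> \<open>The weight of block \<open>N\<close> times the bound from
      \<open>norm_dirichlet_diff_le\<close>.\<close>
    let ?a = "\<lambda>N. \<beta> N * vil_M m N powr (1 / p - 1) * (real B * vil_M m N * indicator (?E N) x)"
    have a: "?a N powr p = c N * vil_M m N * indicator (?E N) x" for N
    proof (cases "x \<in> ?E N")
      case True
      have "real (vil_M m N) powr (1 / p - 1) * real (vil_M m N) = real (vil_M m N) powr (1 / p)"
        using powr_add[of "real (vil_M m N)" "1 / p - 1" 1] M_pos[of N] by simp
      then have "?a N = \<beta> N * real B * real (vil_M m N) powr (1 / p)"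
        using True by (simp add: mult_ac)
      then have "?a N powr p = (\<beta> N * real B * real (vil_M m N) powr (1 / p)) powr p"
        by (rule arg_cong)
      also have "\<dots> = c N * vil_M m N"
        using p nonneg[of N] by (simp add: powr_mult powr_powr c_def)
      finally show ?thesis using True by simp
    qed simp
    have "norm (?f n x) \<le> (\<Sum>N<n. ?a N)"
      unfolding block_martingale_eq
    proof (rule sum_norm_le)
      fix N
      show "norm (?w N * (dirichlet (vil_M m (Suc N)) x - dirichlet (vil_M m N) x)) \<le> ?a N"
        unfolding norm_mult using nonneg norm_dirichlet_diff_le[OF x B]
        by (intro mult_mono) (simp_all add: norm_mult del: vil_M.simps)
    qed
    then have "norm (?f n x) powr p \<le> (\<Sum>N<n. ?a N) powr p"
      using p by (intro powr_mono2) simp_all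
    also have "\<dots> \<le> (\<Sum>N<n. ?a N powr p)"
      using p nonneg by (intro powr_sum_le_sum_powr) simp_all
    finally have "ennreal (norm (?f n x) powr p) \<le> ennreal (\<Sum>N<n. c N * vil_M m N * indicator (?E N) x)"
      unfolding a by (rule ennreal_leI)
    also have "\<dots> = (\<Sum>N<n. ennreal (c N * vil_M m N) * indicator (?E N) x)"
      using c_nonneg by (simp add: sum_ennreal[symmetric] ennreal_mult' ennreal_indicator)
    also have "\<dots> \<le> K x"
      unfolding K_def by (rule sum_le_suminf) auto
    finally show "ennreal (norm (?f n x) powr p) \<le> K x" .
  qed (use p in simp_all)
  have "(\<integral>\<^sup>+x. ennreal_pow (vil_maximal ?f x) p \<partial>vil_measure m) \<le> (\<integral>\<^sup>+x. K x \<partial>vil_measure m)"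
    using bound by (intro nn_integral_mono) (simp only: space_vil_measure)
  also have "\<dots> = (\<Sum>N. ennreal (c N * vil_M m N) * emeasure (vil_measure m) (?E N))"
    unfolding K_def using vil_I_sets
    by (subst nn_integral_suminf) (simp_all add: nn_integral_cmult_indicator)
  also have "\<dots> = (\<Sum>N. ennreal (c N))"
    using M_pos c_nonneg
    by (intro suminf_cong) (simp add: emeasure_vil_I[OF zero_in_group] ennreal_mult'[symmetric])
  also have "\<dots> < \<infinity>"
    using summable c_nonneg unfolding c_def
    by (subst suminf_ennreal2) (simp_all add: summable_mult)
  finally have fin: "(\<integral>\<^sup>+x. ennreal_pow (vil_maximal ?f x) p \<partial>vil_measure m) < \<infinity>" .
  then have "vil_Hp_norm m p ?f < \<infinity>"
    by (simp add: vil_Hp_norm_def vil_Lp_norm_def ennreal_pow_def)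
  then show ?thesis
    by (simp add: vil_Hp_def martingale_block_martingale)
qed

section \<open>Sparse blocks against a given growth rate\<close>

text \<open>Replacing \<open>n\<close> by the start of its block decreases \<open>\<Phi>\<close> or
  keeps it, and lowers \<open>n powr q\<close> by a factor of at most
  \<open>B powr q\<close>.\<close>

lemma M_growth_unbounded:
  assumes B: "\<And>k. m k \<le> B" and "q > 0" and mono: "mono \<Phi>" and pos: "\<And>n. \<Phi> n > 0"
    and lim: "limsup (\<lambda>n. ereal (real n powr q / \<Phi> n)) = \<infinity>"
  shows "\<exists>N\<ge>N0. vil_M m N powr q / \<Phi> (vil_M m N) > C"
proof -
  have B_pos: "B > 0" using B[of 0] m_pos[of 0] by linarith
  \<comment> \<open>The lower bound on \<open>n\<close> forces \<open>N \<ge> N0\<close>; the factor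
    \<open>B powr q\<close> pays for the passage to the block start.\<close>
  obtain n where n: "n \<ge> vil_M m N0" "real n powr q / \<Phi> n > real B powr q * C"
    using lim unfolding limsup_ereal_eq_PInf_iff by blast
  then have "n \<ge> 1" using M_pos[of N0] by linarith
  then obtain N where N: "vil_M m N \<le> n" "n < vil_M m (Suc N)"
    by (rule ex_M_bracket)
  have "N0 \<le> N"
    using n(1) N(2) M_mono[of "Suc N" N0] by (meson leD le_trans not_less_eq_eq)
  have "n \<le> B * vil_M m N"
    using N(2) B[of N] by (simp add: order.trans[OF less_imp_le mult_le_mono1])
  then have "real n \<le> real B * real (vil_M m N)"
    by (simp flip: of_nat_mult)
  then have "real n powr q \<le> (real B * real (vil_M m N)) powr q"
    using \<open>q > 0\<close> by (intro powr_mono2) simp_all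
  also have "\<dots> = real B powr q * real (vil_M m N) powr q" by (simp add: powr_mult)
  finally have "real n powr q / \<Phi> n \<le> real B powr q * real (vil_M m N) powr q / \<Phi> (vil_M m N)"
    using monoD[OF mono N(1)] pos by (intro frac_le) simp_all
  with n(2) have "real B powr q * C < real B powr q * (real (vil_M m N) powr q / \<Phi> (vil_M m N))"
    by simp
  then have "C < real (vil_M m N) powr q / \<Phi> (vil_M m N)"
    using B_pos by (simp only: mult_less_cancel_left_pos powr_gt_zero of_nat_0_less_iff)
  with \<open>N0 \<le> N\<close> show ?thesis by blast
qed

lemma ex_Hp_large_coeff:
  assumes p: "0 < p" "p < 1" and B: "\<And>k. m k \<le> B"
    and \<Phi>: "mono \<Phi>" "\<And>n. \<Phi> n > (0::real)"
    and lim: "limsup (\<lambda>n. ereal (real n powr (1 / p - 1) / \<Phi> n)) = \<infinity>"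
  shows "\<exists>f\<in>vil_Hp m p. limsup (\<lambda>n. ereal (norm (vil_coeff m f n) / \<Phi> n)) = \<infinity>"
proof -
  let ?q = "1 / p - 1"
  define R where "R N = vil_M m N powr ?q / \<Phi> (vil_M m N)" for N
  have large: "\<exists>N\<ge>N0. R N > C" for N0 C
    unfolding R_def using M_growth_unbounded[OF B _ \<Phi> lim] p by simp
  \<comment> \<open>Strict growth makes \<open>\<alpha>\<close> injective, so that
    \<open>inv \<alpha>\<close> recovers \<open>k\<close> in \<open>\<beta>\<close>, and sends the
    indices to infinity.\<close>
  have "\<exists>\<alpha>. \<forall>k. R (\<alpha> k) > 4 powr (k / p) \<and> \<alpha> k < \<alpha> (Suc k)"
  proof (rule dependent_nat_choice)
    show "\<exists>N. R N > 4 powr (real 0 / p)" using large by blast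
    show "\<exists>N'. R N' > 4 powr (real (Suc k) / p) \<and> N < N'" for N k
      using large[of "Suc N"] by (meson Suc_le_lessD)
  qed
  then obtain \<alpha> where \<alpha>: "\<And>k. R (\<alpha> k) > 4 powr (k / p)" and "\<And>k. \<alpha> k < \<alpha> (Suc k)"
    by blast
  then have mono: "strict_mono \<alpha>" by (simp add: strict_mono_Suc_iff)
  define \<beta> where "\<beta> N = (if N \<in> range \<alpha> then 2 powr (- real (inv \<alpha> N) / p) else 0)" for N
  have \<beta>_\<alpha>: "\<beta> (\<alpha> k) = 2 powr (- real k / p)" for k
    using strict_mono_imp_inj_on[OF mono] by (simp add: \<beta>_def)
  have "\<beta> (\<alpha> k) powr p = (1 / 2) ^ k" for k
  proof -
    have "\<beta> (\<alpha> k) powr p = 2 powr (- real k)"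
      using p by (simp only: \<beta>_\<alpha> powr_powr) simp
    then show ?thesis by (simp add: powr_minus powr_realpow power_one_over inverse_eq_divide)
  qed
  then have "summable (\<lambda>k. \<beta> (\<alpha> k) powr p)"
    by (simp add: summable_geometric)
  \<comment> \<open>\<open>\<beta>\<close> vanishes off the range of \<open>\<alpha>\<close>, so the
    geometric series along \<open>\<alpha>\<close> is the whole series.\<close>
  then have "summable (\<lambda>N. \<beta> N powr p)"
    using summable_mono_reindex[OF mono, of "\<lambda>N. \<beta> N powr p"] by (simp add: \<beta>_def)
  then have f: "block_martingale (\<lambda>N. of_real (\<beta> N * vil_M m N powr ?q)) \<in> vil_Hp m p" (is "?f \<in> _")
    by (intro block_martingale_in_Hp[OF p B]) (simp_all add: \<beta>_def)
  have "\<exists>n\<ge>N. norm (vil_coeff m ?f n) / \<Phi> n > C" for C N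
  proof -
    obtain k0 where k0: "C < real k0" using reals_Archimedean2 by blast
    \<comment> \<open>\<open>N\<close> makes the index late enough, \<open>k0\<close> makes the
      ratio exceed \<open>C\<close>.\<close>
    define k where "k = max N k0"
    have "N \<le> k" by (simp add: k_def)
    also have "\<dots> \<le> \<alpha> k" by (rule strict_mono_imp_increasing[OF mono])
    also have "\<dots> \<le> vil_M m (\<alpha> k)" by (rule less_imp_le, rule less_vil_M, rule m_ge_2)
    finally have "N \<le> vil_M m (\<alpha> k)" .
    have "C < real k" using k0 by (simp add: k_def)
    also have "\<dots> < 2 ^ k" by simp
    also have "\<dots> = 2 powr real k" by (simp add: powr_realpow)
    also have "\<dots> \<le> 2 powr (k / p)"
      using p by (intro powr_mono) (simp_all add: field_simps mult_left_le_one_le)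
    \<comment> \<open>The gain \<open>4 powr (k / p)\<close> beats the damping needed for
      summability and still leaves \<open>2 powr (k / p)\<close>.\<close>
    also have "\<dots> = 2 powr (- real k / p) * 4 powr (k / p)"
    proof -
      have "(4::real) powr (k / p) = (2 powr 2) powr (k / p)" by simp
      also have "\<dots> = 2 powr (2 * (k / p))" by (rule powr_powr)
      finally show ?thesis by (simp flip: powr_add)
    qed
    also have "\<dots> \<le> \<beta> (\<alpha> k) * R (\<alpha> k)"
      unfolding \<beta>_\<alpha> using \<alpha>[of k] by (intro mult_left_mono) simp_all
    also have "\<dots> = norm (vil_coeff m ?f (vil_M m (\<alpha> k))) / \<Phi> (vil_M m (\<alpha> k))"
      by (simp add: coeff_block_martingale R_def norm_mult \<beta>_\<alpha>)
    finally show ?thesis using \<open>N \<le> vil_M m (\<alpha> k)\<close> by blast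
  qed
  then have "limsup (\<lambda>n. ereal (norm (vil_coeff m ?f n) / \<Phi> n)) = \<infinity>"
    by (simp only: limsup_ereal_eq_PInf_iff) blast
  with f show ?thesis by blast
qed

end

theorem theorem2p1:
  fixes m :: "nat \<Rightarrow> nat" and p :: real
  assumes "\<And>k. m k \<ge> 2"
    and "\<exists>B. \<forall>k. m k \<le> B"
    and "0 < p" and "p < 1"
  shows "(\<exists>c>0. \<forall>f\<in>vil_Hp m p. \<forall>n\<ge>1.
            norm (vil_coeff m f n) \<le> c * real n powr (1 / p - 1) * enn2real (vil_Hp_norm m p f))
       \<and> (\<forall>\<Phi> :: nat \<Rightarrow> real.
            mono \<Phi> \<longrightarrow> (\<forall>n. \<Phi> n > 0) \<longrightarrow>
            limsup (\<lambda>n. ereal (real n powr (1 / p - 1) / \<Phi> n)) = \<infinity> \<longrightarrow>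
            (\<exists>f\<in>vil_Hp m p. limsup (\<lambda>n. ereal (norm (vil_coeff m f n) / \<Phi> n)) = \<infinity>))"
proof -
  interpret vilenkin m by standard (rule assms(1))
  obtain B where B: "\<And>k. m k \<le> B" using assms(2) by blast
  have "B > 0" using B[of 0] m_pos[of 0] by linarith
  \<comment> \<open>This is the constant of part a); it depends on \<open>p\<close> and the bound of
    \<open>m\<close> only.\<close>
  then have "real B powr (1 / p - 1) > 0" by simp
  moreover have "\<forall>f\<in>vil_Hp m p. \<forall>n\<ge>1. norm (vil_coeff m f n)
      \<le> real B powr (1 / p - 1) * real n powr (1 / p - 1) * enn2real (vil_Hp_norm m p f)"
    using Hp_coeff_bound[OF _ assms(3,4) B] by blast
  ultimately show ?thesis
    using ex_Hp_large_coeff[OF assms(3,4) B] by blast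
qed

end
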